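(* If $G$ is a finite simple undirected AT-free graph having girth at least $5$, then $\mathrm{box}(G)\le 2$.
   Context: $G$ is AT-free if it has no asteroidal triple (independent set of three vertices such that between each pair there is a path avoiding the neighbourhood of the third). The girth is the length of a shortest cycle (an acyclic graph has girth at least $5$). $\mathrm{box}(G)$ is the minimum $k$ such that $G$ is the intersection graph of axis-parallel $k$-dimensional boxes, equivalently the minimum $k$ such that $G$ is the edge-intersection of $k$ interval graphs on $V(G)$. *)

theory Defs
  imports "Graph_Theory.Pair_Digraph" "HOL-Library.Extended_Nat" "HOL-Library.FuncSet"
begin

text \<open>
  A finite simple undirected graph is a \<^locale>\<open>pair_graph\<close>: finite, loop-free, and with a
  symmetric arc relation, an edge \<open>{u, v}\<close> being the two arcs \<open>(u, v)\<close> and \<open>(v, u)\<close>.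
\<close>

definition neighbourhood :: "'a pair_pre_digraph \<Rightarrow> 'a \<Rightarrow> 'a set" where
  "neighbourhood G w = {v. (w, v) \<in> parcs G}"

definition independent :: "'a pair_pre_digraph \<Rightarrow> 'a set \<Rightarrow> bool" where
  "independent G S \<longleftrightarrow> S \<subseteq> pverts G \<and> (\<forall>u\<in>S. \<forall>v\<in>S. (u, v) \<notin> parcs G)"

definition path_avoiding :: "'a pair_pre_digraph \<Rightarrow> 'a \<Rightarrow> 'a \<Rightarrow> 'a set \<Rightarrow> bool" where
  "path_avoiding G u v X \<longleftrightarrow>
     (\<exists>p. pre_digraph.apath (with_proj G) u p v \<and>
          set (pre_digraph.awalk_verts (with_proj G) u p) \<inter> X = {})"

definition asteroidal_triple :: "'a pair_pre_digraph \<Rightarrow> 'a \<Rightarrow> 'a \<Rightarrow> 'a \<Rightarrow> bool" where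
  "asteroidal_triple G a b c \<longleftrightarrow>
     distinct [a, b, c] \<and> independent G {a, b, c} \<and>
     path_avoiding G a b (neighbourhood G c) \<and>
     path_avoiding G b c (neighbourhood G a) \<and>
     path_avoiding G a c (neighbourhood G b)"

definition AT_free :: "'a pair_pre_digraph \<Rightarrow> bool" where
  "AT_free G \<longleftrightarrow> \<not> (\<exists>a b c. asteroidal_triple G a b c)"

text \<open>
  The bound \<open>3 \<le> length p\<close> excludes the closed walks \<open>u, v, u\<close> along a single edge, which
  are cycles of the symmetric digraph but not of the undirected graph. Acyclic graphs have
  girth \<open>\<infinity>\<close>.
\<close>

definition girth :: "'a pair_pre_digraph \<Rightarrow> enat" where
  "girth G = (INF p \<in> {p. pre_digraph.cycle (with_proj G) p \<and> 3 \<le> length p}. enat (length p))"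

text \<open>
  \<open>\<real>\<^sup>k\<close> is represented by the extensional functions on \<open>{..<k}\<close>; \<open>\<real>\<^sup>0\<close> is a single point,
  so complete graphs have boxicity 0.
\<close>

definition is_box :: "nat \<Rightarrow> (nat \<Rightarrow> real) set \<Rightarrow> bool" where
  "is_box k B \<longleftrightarrow>
     (\<exists>l r. (\<forall>i<k. l i \<le> r i) \<and> B = (\<Pi>\<^sub>E i\<in>{..<k}. {l i..r i}))"

definition box_representation ::
    "'a pair_pre_digraph \<Rightarrow> nat \<Rightarrow> ('a \<Rightarrow> (nat \<Rightarrow> real) set) \<Rightarrow> bool" where
  "box_representation G k f \<longleftrightarrow>
     (\<forall>v\<in>pverts G. is_box k (f v)) \<and>
     (\<forall>u\<in>pverts G. \<forall>v\<in>pverts G. u \<noteq> v \<longrightarrow> ((u, v) \<in> parcs G \<longleftrightarrow> f u \<inter> f v \<noteq> {}))"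

definition boxicity :: "'a pair_pre_digraph \<Rightarrow> enat" where
  "boxicity G = (INF k \<in> {k. \<exists>f. box_representation G k f}. enat k)"

end

theory Submission
  imports Defs
begin

text \<open>
  Let \<open>u\<^sub>0, \<dots>, u\<^sub>m\<close> be a longest induced path. Maximality together with the absence of
  asteroidal triples and of cycles of length 3 and 4 forces every other vertex of its component to be
  adjacent to the path, either to exactly one \<open>u\<^sub>i\<close> or to exactly two vertices \<open>u\<^sub>i, u\<^bsub>i+3\<^esub>\<close> with
  which it closes a 5-cycle; these vertices are pairwise non-adjacent, and none of them is attached to
  the inner vertices \<open>u\<^bsub>i+1\<^esub>, u\<^bsub>i+2\<^esub>\<close> of such a 5-cycle. In the first coordinate \<open>u\<^sub>i\<close> is
  \<open>[i, i+1]\<close>, a vertex attached to \<open>u\<^sub>i\<close> only is a private point in the middle part of that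
  interval, and a vertex closing a 5-cycle is \<open>[i+3/4, i+13/4]\<close>. The only false intersections are
  those of the latter with the inner vertices of its 5-cycle. The second coordinate removes them: vertices
  off the path have height 1, inner vertices of 5-cycles height 0, and the remaining path vertices
  are \<open>[0, 1]\<close>.
\<close>

section \<open>Induced paths, and routes that miss a neighbourhood\<close>

text \<open>
  The vertices of the route avoid the neighbourhood of \<open>c\<close>; nothing is required of the trivial route from
  a vertex to itself.
\<close>

definition missing_route :: "('a \<Rightarrow> 'a \<Rightarrow> bool) \<Rightarrow> 'a \<Rightarrow> 'a \<Rightarrow> 'a \<Rightarrow> bool" where
  "missing_route E c = (\<lambda>x y. E x y \<and> \<not> E c x \<and> \<not> E c y)\<^sup>*\<^sup>*"

text \<open>\<open>m\<close> is the index of the last vertex, so the path has \<open>m + 1\<close>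
  vertices; values of \<open>u\<close> beyond \<open>m\<close> are unconstrained.\<close>

definition induced_path :: "('a \<Rightarrow> 'a \<Rightarrow> bool) \<Rightarrow> 'a set \<Rightarrow> (nat \<Rightarrow> 'a) \<Rightarrow> nat \<Rightarrow> bool" where
  "induced_path E S u m \<longleftrightarrow> u ` {..m} \<subseteq> S \<and> inj_on u {..m} \<and>
     (\<forall>i\<le>m. \<forall>j\<le>m. E (u i) (u j) \<longleftrightarrow> j = Suc i \<or> i = Suc j)"

lemma induced_path_shift:
  assumes "induced_path E S u m" "s + k \<le> m"
  shows "induced_path E S (\<lambda>n. u (n + s)) k"
proof -
  have "inj_on (\<lambda>n. u (n + s)) {..k}"
    using assms by (auto simp: induced_path_def intro!: inj_onI dest!: inj_onD)
  then show ?thesis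
    using assms unfolding induced_path_def by (auto simp: image_subset_iff)
qed

lemma induced_path_rev:
  assumes "induced_path E S u m"
  shows "induced_path E S (\<lambda>n. u (m - n)) m"
proof -
  have "inj_on (\<lambda>n. u (m - n)) {..m}"
    using assms by (auto simp: induced_path_def intro!: inj_onI dest!: inj_onD)
  then show ?thesis
    using assms unfolding induced_path_def by (auto simp: image_subset_iff)
qed

lemma missing_route_trans:
  "missing_route E c a b \<Longrightarrow> missing_route E c b d \<Longrightarrow> missing_route E c a d"
  unfolding missing_route_def by (rule rtranclp_trans)

lemma missing_route_edge:
  "E a b \<Longrightarrow> \<not> E c a \<Longrightarrow> \<not> E c b \<Longrightarrow> missing_route E c a b"
  unfolding missing_route_def by auto

lemma missing_route_path3:
  "E a x \<Longrightarrow> E x b \<Longrightarrow> \<not> E c a \<Longrightarrow> \<not> E c x \<Longrightarrow> \<not> E c b \<Longrightarrow> missing_route E c a b"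
  by (rule missing_route_trans[of _ _ _ x]) (simp_all add: missing_route_edge)

lemma missing_route_path4:
  "E a x \<Longrightarrow> E x y \<Longrightarrow> E y b \<Longrightarrow> \<not> E c a \<Longrightarrow> \<not> E c x \<Longrightarrow> \<not> E c y \<Longrightarrow> \<not> E c b
    \<Longrightarrow> missing_route E c a b"
  by (rule missing_route_trans[of _ _ _ x]) (simp_all add: missing_route_edge missing_route_path3)

section \<open>Forbidden configurations around 5-cycles\<close>

text \<open>With all vertices equal, \<open>no_C3\<close> excludes loops. A route between distinct
  vertices has its ends outside the missed neighbourhood, so the routes in \<open>no_AT\<close>
  already make the triple independent.\<close>

locale AT_free_girth5 =
  fixes E :: "'a \<Rightarrow> 'a \<Rightarrow> bool"
  assumes sym: "E x y \<Longrightarrow> E y x"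
    and no_C3: "E x y \<Longrightarrow> E y z \<Longrightarrow> \<not> E z x"
    and no_C4: "E a b \<Longrightarrow> E b c \<Longrightarrow> E c d \<Longrightarrow> a \<noteq> c \<Longrightarrow> b \<noteq> d \<Longrightarrow> \<not> E d a"
    and no_AT: "distinct [a, b, c] \<Longrightarrow> missing_route E c a b \<Longrightarrow> missing_route E a b c \<Longrightarrow>
      missing_route E b a c \<Longrightarrow> False"
begin

lemma irrefl: "\<not> E x x"
  using no_C3 by blast

lemma adj_commute: "E x y \<longleftrightarrow> E y x"
  using sym by blast

lemma induced_pathI:
  assumes "\<And>i. i \<le> m \<Longrightarrow> u i \<in> S"
    and "\<And>i j. i < j \<Longrightarrow> j \<le> m \<Longrightarrow> u i \<noteq> u j"
    and "\<And>i j. i < j \<Longrightarrow> j \<le> m \<Longrightarrow> E (u i) (u j) \<longleftrightarrow> j = Suc i"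
  shows "induced_path E S u m"
  unfolding induced_path_def
proof (intro conjI allI impI)
  show "u ` {..m} \<subseteq> S" using assms(1) by auto
  show "inj_on u {..m}"
    using assms(2) by (metis atMost_iff inj_onI linorder_neqE_nat)
  fix i j assume "i \<le> m" "j \<le> m"
  then show "E (u i) (u j) \<longleftrightarrow> j = Suc i \<or> i = Suc j"
    using assms(3)[of i j] assms(3)[of j i] irrefl[of "u i"] adj_commute[of "u i" "u j"]
    by (cases i j rule: linorder_cases) auto
qed

text \<open>\<open>case_nat x u\<close> is the sequence \<open>x, u 0, u 1, ...\<close>: the form in
  which a path is lengthened at its start.\<close>

lemma induced_path_Cons:
  assumes "induced_path E S u m" "x \<in> S" "x \<notin> u ` {..m}"
    and "\<And>n. n \<le> m \<Longrightarrow> E x (u n) \<longleftrightarrow> n = 0"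
  shows "induced_path E S (case_nat x u) (Suc m)"
proof (rule induced_pathI)
  fix i assume "i \<le> Suc m"
  then show "case_nat x u i \<in> S"
    using assms(1,2) by (auto simp: induced_path_def split: nat.split)
next
  fix i j assume "i < j" "j \<le> Suc m"
  then obtain k where k: "j = Suc k" "k \<le> m" by (cases j) auto
  show "case_nat x u i \<noteq> case_nat x u j"
    using assms(1,3) \<open>i < j\<close> k
    by (cases i) (auto simp: induced_path_def inj_on_def)
  show "E (case_nat x u i) (case_nat x u j) \<longleftrightarrow> j = Suc i"
    using assms(1,4) \<open>i < j\<close> k
    by (cases i) (auto simp: induced_path_def)
qed

text \<open>\<open>p\<close>, \<open>q\<close> and the opposite vertex \<open>v3\<close> form an
  asteroidal triple with routes along the cycle; an adjacency spoiling a route would close a cycle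
  of length 3 or 4.\<close>

lemma no_pendants_on_adjacent_C5_vertices:
  assumes "E v0 v1" "E v1 v2" "E v2 v3" "E v3 v4" "E v4 v0"
    and "E p v0" "E q v1" "p \<noteq> v1" "p \<noteq> v4" "q \<noteq> v0" "q \<noteq> v2"
  shows False
proof (rule no_AT[of p q v3])
  have d: "v0 \<noteq> v2" "v0 \<noteq> v3" "v1 \<noteq> v3" "v1 \<noteq> v4" "v2 \<noteq> v4" "v0 \<noteq> v1"
    using assms(1-5) no_C3 irrefl sym by blast+
  have n: "\<not> E v3 v0" "\<not> E v3 v1" "\<not> E p v1" "\<not> E q v0"
    using assms no_C3 sym by blast+
  have f: "\<not> E p v3" "\<not> E q v3" "\<not> E p q" "\<not> E p v2" "\<not> E q v4"
    using assms d no_C4 sym by metis+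
  show "distinct [p, q, v3]" using n f assms sym by auto
  show "missing_route E v3 p q"
    by (rule missing_route_path4[of _ _ v0 v1]) (use n f assms sym in blast)+
  show "missing_route E p q v3"
    by (rule missing_route_path4[of _ _ v1 v2]) (use n f assms sym irrefl in blast)+
  show "missing_route E q p v3"
    by (rule missing_route_path4[of _ _ v0 v4]) (use n f assms sym irrefl in blast)+
qed

text \<open>The 5-cycles \<open>v0 v1 v2 v3 v4\<close> and \<open>v0 v1 w2 w3 w4\<close> share the
  edge \<open>v0 v1\<close>. Then \<open>v2\<close>, \<open>v4\<close>, \<open>w3\<close> form an
  asteroidal triple, with routes via \<open>v3\<close>, via \<open>v0, w4\<close> and via
  \<open>v1, w2\<close>.\<close>

lemma no_C5_pair_sharing_edge:
  assumes "E v0 v1" "E v1 v2" "E v2 v3" "E v3 v4" "E v4 v0"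
    and "E v1 w2" "E w2 w3" "E w3 w4" "E w4 v0"
    and "w3 \<noteq> v2" "w3 \<noteq> v4" "\<not> E w3 v2" "\<not> E w3 v3" "\<not> E w3 v4"
  shows False
proof (rule no_AT[of v2 v4 w3])
  have d: "v0 \<noteq> v2" "v1 \<noteq> v4" "v2 \<noteq> v4" "v1 \<noteq> w4" "v0 \<noteq> w2"
    using assms(1-9) no_C3 irrefl sym by blast+
  have n: "\<not> E v2 v4" "\<not> E v2 v0" "\<not> E v4 v1"
    using assms no_C3 sym by blast+
  have f: "\<not> E v2 w4" "\<not> E v4 w2"
    using assms d no_C4 sym by metis+
  show "distinct [v2, v4, w3]" using d assms by auto
  show "missing_route E w3 v2 v4"
    by (rule missing_route_path3[of _ _ v3]) (use n f assms sym in blast)+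
  show "missing_route E v2 v4 w3"
    by (rule missing_route_path4[of _ _ v0 w4]) (use n f assms sym irrefl in blast)+
  show "missing_route E v4 v2 w3"
    by (rule missing_route_path4[of _ _ v1 w2]) (use n f assms sym irrefl in blast)+
qed

end

section \<open>Attachments to a longest induced path\<close>

text \<open>Closedness makes \<open>S\<close> a union of components, so that components can be split
  off one at a time; \<open>u\<close> is longest within all of \<open>S\<close>.\<close>

locale longest_induced_path = AT_free_girth5 E for E :: "'a \<Rightarrow> 'a \<Rightarrow> bool" +
  fixes S :: "'a set" and u :: "nat \<Rightarrow> 'a" and m :: nat
  assumes closed: "x \<in> S \<Longrightarrow> E x y \<Longrightarrow> y \<in> S"
    and path: "induced_path E S u m"
    and longest: "induced_path E S v k \<Longrightarrow> k \<le> m"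
begin

lemma adj: "i \<le> m \<Longrightarrow> j \<le> m \<Longrightarrow> E (u i) (u j) \<longleftrightarrow> j = Suc i \<or> i = Suc j"
  using path by (auto simp: induced_path_def)

lemma vertex_eq: "i \<le> m \<Longrightarrow> j \<le> m \<Longrightarrow> u i = u j \<longleftrightarrow> i = j"
  using path by (auto simp: induced_path_def inj_on_def)

lemma vertex_in: "i \<le> m \<Longrightarrow> u i \<in> S"
  using path by (auto simp: induced_path_def)

lemma nbr_in: "E w (u i) \<Longrightarrow> i \<le> m \<Longrightarrow> w \<in> S"
  using closed vertex_in sym by blast

text \<open>Carries statements about the start of the path over to its end.\<close>

lemma reversed: "longest_induced_path E S (\<lambda>n. u (m - n)) m"
  using induced_path_rev[OF path] closed longest by unfold_locales auto

lemma route_along: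
  assumes "i \<le> k" "k \<le> m" "\<And>n. i \<le> n \<Longrightarrow> n \<le> k \<Longrightarrow> \<not> E c (u n)"
  shows "missing_route E c (u i) (u k)"
  using assms
proof (induction k rule: dec_induct)
  case base
  then show ?case by (simp add: missing_route_def)
next
  case (step n)
  have "missing_route E c (u n) (u (Suc n))"
    by (rule missing_route_edge) (use step adj in auto)
  then show ?case using step missing_route_trans[of E c "u i" "u n"] by force
qed

abbreviation off :: "'a \<Rightarrow> bool" where
  "off w \<equiv> w \<notin> u ` {..m}"

lemma off_neq: "off w \<Longrightarrow> i \<le> m \<Longrightarrow> w \<noteq> u i" by auto

text \<open>A gap of 1 closes a triangle and a gap of 2 a 4-cycle. For a gap of at least 4,
  \<open>w\<close> and the first and last path vertices inside the gap form an asteroidal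
  triple.\<close>

lemma consecutive_nbrs:
  assumes "off w" "i < k" "k \<le> m" "E w (u i)" "E w (u k)"
    and "\<And>n. i < n \<Longrightarrow> n < k \<Longrightarrow> \<not> E w (u n)"
  shows "k = i + 3"
proof (rule ccontr)
  assume "k \<noteq> i + 3"
  then consider "k = Suc i" | "k = Suc (Suc i)" | "i + 4 \<le> k" using assms(2) by linarith
  then show False
  proof cases
    case 1
    then show ?thesis using assms adj no_C3[of w "u i" "u k"] sym by auto
  next
    case 2
    then show ?thesis
      using assms adj[of i "Suc i"] adj[of "Suc i" k] no_C4[of w "u i" "u (Suc i)" "u k"] sym
        vertex_eq[of i k] off_neq[of w "Suc i"] by auto
  next
    case 3
    have nw: "\<not> E (u n) w" if "i < n" "n < k" for n
      using assms(6) that sym by blast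
    show ?thesis
    proof (rule no_AT[of w "u (Suc i)" "u (k - 1)"])
      show "distinct [w, u (Suc i), u (k - 1)]"
        using 3 assms off_neq[OF assms(1)] vertex_eq by auto
      show "missing_route E (u (k - 1)) w (u (Suc i))"
        by (rule missing_route_path3[of _ _ "u i"]) (use 3 assms nw adj sym in auto)
      show "missing_route E w (u (Suc i)) (u (k - 1))"
        by (rule route_along) (use 3 assms in auto)
      show "missing_route E (u (Suc i)) w (u (k - 1))"
        by (rule missing_route_path3[of _ _ "u k"]) (use 3 assms nw adj sym in auto)
    qed
  qed
qed

text \<open>Consecutive neighbours are 3 apart. A third one, at \<open>i + 6\<close>, would give two
  5-cycles sharing the edge from \<open>w\<close> to \<open>u (i + 3)\<close>.\<close>

lemma nbr_gap:
  assumes "off w" "i < k" "k \<le> m" "E w (u i)" "E w (u k)"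
  shows "k = i + 3"
proof -
  have next_nbr: "E w (u (j + 3)) \<and> j + 3 \<le> k" if "j < k" "E w (u j)" for j
  proof -
    define l where "l = (LEAST n. j < n \<and> E w (u n))"
    have l: "j < l" "E w (u l)"
      using LeastI[of "\<lambda>n. j < n \<and> E w (u n)" k] that assms unfolding l_def by auto
    have "l \<le> k"
      unfolding l_def by (rule Least_le) (use that assms in auto)
    have "\<not> E w (u n)" if "j < n" "n < l" for n
      using not_less_Least[of n "\<lambda>n. j < n \<and> E w (u n)"] that unfolding l_def by auto
    then have "l = j + 3"
      using consecutive_nbrs[of w j l] l \<open>l \<le> k\<close> assms that by auto
    then show ?thesis using l \<open>l \<le> k\<close> by auto
  qed
  have 1: "E w (u (i + 3))" "i + 3 \<le> k" using next_nbr assms by auto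
  show ?thesis
  proof (rule ccontr)
    assume "k \<noteq> i + 3"
    then have 2: "E w (u (i + 6))" "i + 6 \<le> k"
      using next_nbr[of "i + 3"] 1 by (auto simp: add.commute)
    show False
      by (rule no_C5_pair_sharing_edge[of "u (i + 3)" w "u i" "u (i + 1)" "u (i + 2)"
            "u (i + 6)" "u (i + 5)" "u (i + 4)"])
        (use 1 2 assms adj vertex_eq sym in auto)
  qed
qed

lemma no_nbr_near:
  assumes "off w" "E w (u i)" "i \<le> m" "j \<le> m" "j \<noteq> i" "j \<noteq> i + 3" "i \<noteq> j + 3"
  shows "\<not> E w (u j)"
  using nbr_gap[of w i j] nbr_gap[of w j i] assms by (metis linorder_neqE_nat)

text \<open>Otherwise \<open>u 0\<close> is the only neighbour of \<open>w\<close> on the path, and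
  putting \<open>w\<close> in front gives a longer induced path.\<close>

lemma nbr_of_start_closes_C5:
  assumes "off w" "E w (u 0)"
  shows "3 \<le> m \<and> E w (u 3)"
proof (rule ccontr)
  assume "\<not> ?thesis"
  then have "E w (u n) \<longleftrightarrow> n = 0" if "n \<le> m" for n
    using nbr_gap[of w 0 n] that assms by (metis add_0 gr0I)
  from induced_path_Cons[OF path _ assms(1) this] nbr_in[OF assms(2)]
  have "induced_path E S (case_nat w u) (Suc m)" by auto
  then show False using longest by fastforce
qed

text \<open>For \<open>i > 0\<close>, \<open>u (i - 1)\<close> and \<open>x\<close> hang on adjacent
  vertices of the 5-cycle. For \<open>i = 0\<close> that predecessor is missing, and either an
  asteroidal triple or a longer path appears.\<close>

lemma nothing_attached_inside_C5_left:
  assumes "off w" "E w (u i)" "E w (u (i + 3))" "i + 3 \<le> m"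
    and "off x" "x \<noteq> w" "E x (u (i + 1))"
  shows False
proof (cases "i = 0")
  case False
  show ?thesis
    by (rule no_pendants_on_adjacent_C5_vertices[of "u i" "u (i + 1)" "u (i + 2)" "u (i + 3)" w
          "u (i - 1)" x])
      (use False assms adj vertex_eq sym off_neq[OF assms(1)] off_neq[OF assms(5)] in auto)
next
  case True
  note a = assms[unfolded True, simplified]
  have xw: "\<not> E x w"
    using no_C4[of x w "u 0" "u 1"] a adj[of 0 1] off_neq[OF a(1), of 1] off_neq[OF a(5), of 0] sym
    by auto
  have w: "\<not> E w (u n)" if "n \<le> m" "n \<noteq> 0" "n \<noteq> 3" for n
    using no_nbr_near[of w 0 n] that a by auto
  have w': "\<not> E (u n) w" if "n \<le> m" "n \<noteq> 0" "n \<noteq> 3" for n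
    using w[OF that] sym by blast
  show False
  \<comment> \<open>Since \<open>x\<close> is attached to \<open>u 1\<close>, its only possible
    further neighbour on the path is \<open>u 4\<close>.\<close>
  proof (cases "4 \<le> m \<and> E x (u 4)")
    case True
    show ?thesis
    proof (rule no_AT[of "u 1" "u 4" w])
      show "distinct [u 1, u 4, w]"
        using True vertex_eq off_neq[OF a(1), of 1] off_neq[OF a(1), of 4] by auto
      show "missing_route E w (u 1) (u 4)"
        by (rule missing_route_path3[of _ _ x]) (use True a xw w sym in auto)
      show "missing_route E (u 1) (u 4) w"
        by (rule missing_route_path3[of _ _ "u 3"]) (use True a adj w' sym in auto)
      show "missing_route E (u 4) (u 1) w"
        by (rule missing_route_path3[of _ _ "u 0"]) (use True a adj w' sym in auto)
    qed
  next
    case False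
    have x: "\<not> E x (u n)" if "n \<le> m" "n \<noteq> 1" for n
      using no_nbr_near[of x 1 n] that a False by auto
    have in0: "u 0 \<noteq> w" "\<And>n. n \<le> m - 3 \<Longrightarrow> u 0 \<noteq> u (n + 3)"
      and in1: "u 1 \<noteq> u 0" "u 1 \<noteq> w" "\<And>n. n \<le> m - 3 \<Longrightarrow> u 1 \<noteq> u (n + 3)"
      using off_neq[OF a(1)] vertex_eq a by fastforce+
    have u0: "\<not> E (u 0) (u (n + 3))" and u1: "\<not> E (u 1) (u (n + 3))" if "n \<le> m - 3" for n
      using adj that a by auto
    have u10: "E (u 1) (u 0)" using adj a by auto
    have xS: "x \<in> S" using nbr_in[of x 1] a by auto
    txt \<open>Running around the 5-cycle the other way makes room for \<open>x\<close> at the start: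
      \<open>x, u 1, u 0, w, u 3, \<dots>, u m\<close> is induced and longer.\<close>
    have p: "induced_path E S (\<lambda>n. u (n + 3)) (m - 3)"
      by (rule induced_path_shift[OF path]) (use a in auto)
    have "induced_path E S (case_nat w (\<lambda>n. u (n + 3))) (Suc (m - 3))"
      by (rule induced_path_Cons[OF p]) (use a w nbr_in off_neq[OF a(1)] in auto)
    then have "induced_path E S (case_nat (u 0) (case_nat w (\<lambda>n. u (n + 3)))) (Suc (Suc (m - 3)))"
      by (rule induced_path_Cons)
        (use a vertex_in[of 0] sym[OF a(2)] u0 in \<open>auto simp: in0 split: nat.splits\<close>)
    then have "induced_path E S (case_nat (u 1) (case_nat (u 0) (case_nat w (\<lambda>n. u (n + 3)))))
       (Suc (Suc (Suc (m - 3))))"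
      by (rule induced_path_Cons)
        (use a w'[of 1] vertex_in[of 1] u1 u10 in \<open>auto simp: in1[simplified] split: nat.splits\<close>)
    then have "induced_path E S
       (case_nat x (case_nat (u 1) (case_nat (u 0) (case_nat w (\<lambda>n. u (n + 3))))))
       (Suc (Suc (Suc (Suc (m - 3)))))"
      by (rule induced_path_Cons)
        (use a xS x xw off_neq[OF a(5)] in \<open>auto split: nat.splits\<close>)
    then show False using longest a by fastforce
  qed
qed

lemma off_reversed: "(w \<notin> (\<lambda>n. u (m - n)) ` {..m}) \<longleftrightarrow> off w"
proof -
  have "(\<lambda>n. u (m - n)) ` {..m} = u ` ((\<lambda>n. m - n) ` {..m})" by (simp add: image_image)
  also have "(\<lambda>n. m - n) ` {..m} = {..m}"
    by (auto simp: image_iff) (metis atMost_iff diff_diff_cancel diff_le_self)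
  finally show ?thesis by simp
qed

text \<open>The right inner vertex of the 5-cycle is the left one for the reversed path, where the
  cycle starts at index \<open>m - k\<close>.\<close>

lemma nothing_attached_inside_C5:
  assumes "off w" "E w (u i)" "E w (u k)" "k \<le> m" "i < j" "j < k" "off x" "E x (u j)"
  shows False
proof -
  have k: "k = i + 3" using nbr_gap assms by auto
  have "x \<noteq> w" using nbr_gap[of w i j] assms k by auto
  show False
  proof (cases "j = i + 1")
    case True
    then show ?thesis using nothing_attached_inside_C5_left[of w i x] assms k \<open>x \<noteq> w\<close> by auto
  next
    case False
    then have j: "j = i + 2" using assms k by auto
    interpret rev: longest_induced_path E S "\<lambda>n. u (m - n)" m by (rule reversed)
    have "m - (m - k) = k" "m - (m - k + 3) = i" "m - (m - k + 1) = j"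
      using assms k j by auto
    then show ?thesis
      using rev.nothing_attached_inside_C5_left[of w "m - k" x] assms k \<open>x \<noteq> w\<close>
      unfolding off_reversed by auto
  qed
qed

text \<open>The truncated differences add up to the distance of the indices. Distance 0 gives a
  triangle, 1 a 4-cycle, and at least 3 the asteroidal triple \<open>w\<close>,
  \<open>u (i + 1)\<close>, \<open>u k\<close>. At distance 2, a further neighbour of
  \<open>w\<close> or \<open>w'\<close> would give two 5-cycles sharing an edge; without one, the
  path can be lengthened.\<close>

lemma closest_attached_not_adjacent:
  assumes "off w" "off w'" "E w w'" "E w (u i)" "E w' (u k)" "i \<le> k" "k \<le> m"
    and closest: "\<And>i' k'. i' \<le> m \<Longrightarrow> k' \<le> m \<Longrightarrow> E w (u i') \<Longrightarrow> E w' (u k') \<Longrightarrow>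
      k - i \<le> (i' - k') + (k' - i')"
  shows False
proof -
  have "k \<noteq> i" using assms no_C3[of w w' "u k"] sym by auto
  moreover have "k \<noteq> Suc i"
    using assms no_C4[of w "u i" "u k" w'] sym adj[of i k] off_neq[of w k] off_neq[of w' i] by auto
  moreover have False if "i + 3 \<le> k"
  proof (rule no_AT[of w "u (Suc i)" "u k"])
    have w: "\<not> E w (u n)" if "i < n" "n \<le> k" for n
      using closest[of n k] that assms by auto
    have nw: "\<not> E (u n) w" if "i < n" "n \<le> k" for n
      using w[OF that] sym by blast
    have nw': "\<not> E (u n) w'" if "i \<le> n" "n < k" for n
      using closest[of i n] that assms adj_commute[of "u n" w'] by auto
    show "distinct [w, u (Suc i), u k]"
      using that assms off_neq[OF assms(1)] vertex_eq by auto
    show "missing_route E (u k) w (u (Suc i))"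
      by (rule missing_route_path3[of _ _ "u i"]) (use that assms adj nw sym in auto)
    show "missing_route E w (u (Suc i)) (u k)"
      by (rule route_along) (use that assms w in auto)
    show "missing_route E (u (Suc i)) w (u k)"
      by (rule missing_route_path3[of _ _ w']) (use that assms adj nw nw' sym in auto)
  qed
  ultimately have k: "k = i + 2" using assms(6) by force
  have w: "E w (u n) \<longleftrightarrow> n = i" if "n \<le> m" for n
  proof
    assume n: "E w (u n)"
    show "n = i"
    proof (rule ccontr)
      assume "n \<noteq> i"
      then have "n = i + 3 \<or> i = n + 3" using no_nbr_near[of w i n] n that assms by auto
      moreover have "n \<noteq> i + 3" using closest[of n k] n that assms(1-7) k by auto
      ultimately have i: "i = n + 3" by auto
      show False
        by (rule no_C5_pair_sharing_edge[of "u i" w "u n" "u (n + 1)" "u (n + 2)"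
              w' "u k" "u (i + 1)"])
          (use i k assms n adj vertex_eq sym in auto)
    qed
  qed (use assms in auto)
  have w': "E w' (u n) \<longleftrightarrow> n = k" if "n \<le> m" for n
  proof
    assume n: "E w' (u n)"
    show "n = k"
    proof (rule ccontr)
      assume "n \<noteq> k"
      then have "n = k + 3 \<or> k = n + 3" using no_nbr_near[of w' k n] n that assms by auto
      moreover have "k \<noteq> n + 3" using closest[of i n] n that assms(1-7) k by auto
      ultimately have n': "n = k + 3" by auto
      show False
        by (rule no_C5_pair_sharing_edge[of "u k" w' "u n" "u (k + 2)" "u (k + 1)"
              w "u i" "u (i + 1)"])
          (use n' k that assms n adj vertex_eq sym in auto)
    qed
  qed (use assms in auto)
  txt \<open>Replacing \<open>u (i + 1)\<close> by the detour through \<open>w\<close> and \<open>w'\<close> lengthens the path.\<close>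
  define v where "v n = (if n \<le> i then u n else if n = i + 1 then w else if n = i + 2 then w'
    else u (n - 1))" for n
  have "induced_path E S v (Suc m)"
  proof (rule induced_pathI)
    fix n assume "n \<le> Suc m"
    then show "v n \<in> S"
      using vertex_in nbr_in assms by (auto simp: v_def)
  next
    fix a b assume ab: "a < b" "b \<le> Suc m"
    show "v a \<noteq> v b"
      using ab k assms vertex_eq off_neq[OF assms(1)] off_neq[OF assms(2)] irrefl
      by (auto simp: v_def)
    show "E (v a) (v b) \<longleftrightarrow> b = Suc a"
      using ab k assms(3,6,7) adj w w' adj_commute[of "u a" w] adj_commute[of "u a" w']
      by (auto simp: v_def)
  qed
  then show False using longest by fastforce
qed

text \<open>Choose attachments at least distance; exchanging \<open>w\<close> and \<open>w'\<close>
  puts their indices in order.\<close>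

lemma attached_not_adjacent:
  assumes "off w" "off w'" "E w (u i)" "E w' (u k)" "i \<le> m" "k \<le> m"
  shows "\<not> E w w'"
proof
  assume ww: "E w w'"
  define P where "P = (\<lambda>(i, k). i \<le> m \<and> k \<le> m \<and> E w (u i) \<and> E w' (u k))"
  define d where "d = (\<lambda>(i, k). (i - k) + (k - i) :: nat)"
  have "P (i, k)" using assms by (simp add: P_def)
  then obtain q where q: "P q" "\<And>q'. P q' \<Longrightarrow> d q \<le> d q'"
    using ex_has_least_nat[of P _ d] by blast
  obtain a b where "q = (a, b)" by (cases q)
  then have ab: "a \<le> m" "b \<le> m" "E w (u a)" "E w' (u b)"
    and least: "\<And>a' b'. a' \<le> m \<Longrightarrow> b' \<le> m \<Longrightarrow> E w (u a') \<Longrightarrow> E w' (u b') \<Longrightarrow>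
      (a - b) + (b - a) \<le> (a' - b') + (b' - a')"
    using q by (auto simp: P_def d_def)
  show False
  proof (cases "a \<le> b")
    case True
    show ?thesis
      by (rule closest_attached_not_adjacent[OF assms(1,2) ww ab(3,4) True ab(2)])
        (use least True in force)
  next
    case False
    show ?thesis
      by (rule closest_attached_not_adjacent[OF assms(2,1) sym[OF ww] ab(4,3) _ ab(1)])
        (use least False in \<open>force simp: add.commute\<close>)+
  qed
qed

text \<open>Replacing \<open>u 0\<close> by \<open>z, w\<close> gives a longer induced path.\<close>

lemma no_pendant_path_near_start:
  assumes "1 \<le> m" "off w" "off z" "E z w"
    and "\<And>n. n \<le> m \<Longrightarrow> E w (u n) \<longleftrightarrow> n = 1" "\<And>n. n \<le> m \<Longrightarrow> \<not> E z (u n)"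
  shows False
proof -
  have "w \<in> S" using assms(1,5) nbr_in by auto
  then have "z \<in> S" using assms(4) closed sym by blast
  have p: "induced_path E S (\<lambda>n. u (n + 1)) (m - 1)"
    by (rule induced_path_shift[OF path]) (use assms in auto)
  have "induced_path E S (case_nat w (\<lambda>n. u (n + 1))) (Suc (m - 1))"
    by (rule induced_path_Cons[OF p]) (use assms \<open>w \<in> S\<close> off_neq[OF assms(2)] in auto)
  then have "induced_path E S (case_nat z (case_nat w (\<lambda>n. u (n + 1)))) (Suc (Suc (m - 1)))"
    by (rule induced_path_Cons)
      (use assms \<open>z \<in> S\<close> off_neq[OF assms(3)] irrefl in \<open>auto split: nat.splits\<close>)
  then show False using longest assms by fastforce
qed

text \<open>This makes the path with its attached vertices a whole component. An outside
  \<open>z\<close> has no neighbour on the path. If \<open>w\<close> closes a 5-cycle,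
  \<open>z\<close> and a path vertex next to the cycle hang on adjacent cycle vertices, unless the
  path has only the four vertices of that cycle. If \<open>w\<close> has one neighbour, it is
  neither an end of the path nor next to one, by maximality.\<close>

lemma nbr_of_attached_on_path:
  assumes "off w" "E w (u i)" "i \<le> m" "E z w"
  shows "\<not> off z"
proof
  assume z: "off z"
  have zu: "\<not> E z (u n)" if "n \<le> m" for n
    using attached_not_adjacent[of z w n i] that z assms by auto
  have C5: False if a: "E w (u a)" "E w (u (a + 3))" "a + 3 \<le> m" for a
  proof -
    consider "0 < a" | "a = 0" "3 < m" | "a = 0" "m = 3" using a by linarith
    then show False
    proof cases
      case 1
      show ?thesis
        by (rule no_pendants_on_adjacent_C5_vertices[of w "u a" "u (a + 1)" "u (a + 2)" "u (a + 3)"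
              z "u (a - 1)"])
          (use 1 a assms z adj vertex_eq sym off_neq[OF assms(1)] off_neq[OF z] in auto)
    next
      case 2
      show ?thesis
        by (rule no_pendants_on_adjacent_C5_vertices[of w "u 3" "u 2" "u 1" "u 0" z "u 4"])
          (use 2 a assms z adj vertex_eq sym off_neq[OF assms(1)] off_neq[OF z] in auto)
    next
      case 3
      have "w \<in> S" using assms nbr_in by auto
      then have "z \<in> S" using assms(4) closed sym by blast
      have wn: "\<not> E w (u n)" if "0 < n" "n \<le> 2" for n
        using nbr_gap[of w 0 n] that a 3 assms by auto
      \<comment> \<open>The shift by 0 only truncates the path at \<open>u 2\<close>; with
        \<open>z, w\<close> in front its last index is 4, more than \<open>m = 3\<close>.\<close>
      have p: "induced_path E S (\<lambda>n. u (n + 0)) 2"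
        by (rule induced_path_shift[OF path]) (use 3 in auto)
      have "induced_path E S (case_nat w (\<lambda>n. u (n + 0))) (Suc 2)"
        by (rule induced_path_Cons[OF p])
          (use 3 a wn \<open>w \<in> S\<close> assms(1) in \<open>auto intro: gr0I\<close>)
      then have "induced_path E S (case_nat z (case_nat w (\<lambda>n. u (n + 0)))) (Suc (Suc 2))"
        by (rule induced_path_Cons)
          (use 3 assms(4) zu \<open>z \<in> S\<close> z irrefl in \<open>auto split: nat.splits\<close>)
      then show False using longest 3 by fastforce
    qed
  qed
  have only: "E w (u n) \<longleftrightarrow> n = i" if "n \<le> m" for n
    using no_nbr_near[of w i n] C5[of i] C5[of n] that assms by auto
  interpret rev: longest_induced_path E S "\<lambda>n. u (m - n)" m by (rule reversed)
  have "i \<noteq> 0"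
    using nbr_of_start_closes_C5[of w] only[of 3] assms by auto
  moreover have "i \<noteq> m"
    using rev.nbr_of_start_closes_C5[of w, unfolded off_reversed] only[of "m - 3"] assms by auto
  moreover have "i \<noteq> 1"
    using no_pendant_path_near_start[of w z] assms only zu z by auto
  moreover have "i \<noteq> m - 1"
  proof
    assume "i = m - 1"
    with \<open>i \<noteq> 0\<close> have "E w (u (m - n)) \<longleftrightarrow> n = 1" if "n \<le> m" for n
      using only[of "m - n"] that by auto
    then show False
      using rev.no_pendant_path_near_start[of w z, unfolded off_reversed] \<open>i \<noteq> 0\<close> assms zu z
      by auto
  qed
  ultimately have i: "2 \<le> i" "i + 2 \<le> m" using assms(3) by auto
  \<comment> \<open>Three legs of length 2 meet in \<open>u i\<close>, one of them through
    \<open>w\<close>; their far ends form the asteroidal triple.\<close>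
  show False
  proof (rule no_AT[of "u (i - 2)" "u (i + 2)" z])
    show "distinct [u (i - 2), u (i + 2), z]"
      using i vertex_eq[of "i - 2" "i + 2"] off_neq[OF z, of "i - 2"] off_neq[OF z, of "i + 2"]
      by force
    show "missing_route E z (u (i - 2)) (u (i + 2))"
      by (rule route_along) (use i zu in auto)
    have "missing_route E (u (i - 2)) (u (i + 2)) (u i)"
      by (rule missing_route_path3[of _ _ "u (i + 1)"]) (use i adj in auto)
    moreover have "missing_route E (u (i - 2)) (u i) z"
      by (rule missing_route_path3[of _ _ w])
        (use i adj assms sym only[of "i - 2"] zu[of "i - 2"] adj_commute[of "u (i - 2)"] in auto)
    ultimately show "missing_route E (u (i - 2)) (u (i + 2)) z"
      by (rule missing_route_trans)
    have "missing_route E (u (i + 2)) (u (i - 2)) (u i)"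
      by (rule route_along) (use i adj in auto)
    moreover have "missing_route E (u (i + 2)) (u i) z"
      by (rule missing_route_path3[of _ _ w])
        (use i adj assms sym only[of "i + 2"] zu[of "i + 2"] adj_commute[of "u (i + 2)"] in auto)
    ultimately show "missing_route E (u (i + 2)) (u (i - 2)) z"
      by (rule missing_route_trans)
  qed
qed

end

section \<open>Systems of two-dimensional boxes and their disjoint union\<close>

text \<open>The Boolean index selects the coordinate; \<open>True\<close> is the first one.\<close>

definition boxes ::
    "('a \<Rightarrow> 'a \<Rightarrow> bool) \<Rightarrow> 'a set \<Rightarrow> (bool \<Rightarrow> 'a \<Rightarrow> real) \<Rightarrow> (bool \<Rightarrow> 'a \<Rightarrow> real) \<Rightarrow> bool" where
  "boxes E D l r \<longleftrightarrow> (\<forall>x\<in>D. \<forall>b. l b x \<le> r b x) \<and>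
     (\<forall>x\<in>D. \<forall>y\<in>D. x \<noteq> y \<longrightarrow> (E x y \<longleftrightarrow> (\<forall>b. l b x \<le> r b y \<and> l b y \<le> r b x)))"

text \<open>Translating the boxes of \<open>B\<close> in the first coordinate beyond all boxes of
  \<open>A\<close> preserves the intersections within \<open>B\<close>.\<close>

lemma boxes_Un:
  assumes "boxes E A l r" "boxes E B l' r'" "finite A" "finite B" "A \<inter> B = {}"
    and "\<And>x y. x \<in> A \<Longrightarrow> y \<in> B \<Longrightarrow> \<not> E x y \<and> \<not> E y x"
  shows "\<exists>l r. boxes E (A \<union> B) l r"
proof -
  \<comment> \<open>\<open>insert 0\<close> keeps \<open>Max\<close> and \<open>Min\<close>
    meaningful for empty sets; the added 1 makes the separation strict.\<close>
  define s where "s = Max (insert 0 (r True ` A)) - Min (insert 0 (l' True ` B)) + 1"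
  have s: "r True x < l' True y + s" if "x \<in> A" "y \<in> B" for x y
  proof -
    have "r True x \<le> Max (insert 0 (r True ` A))" "Min (insert 0 (l' True ` B)) \<le> l' True y"
      using assms(3,4) that by auto
    then show ?thesis unfolding s_def by linarith
  qed
  define L where "L b x = (if x \<in> A then l b x else l' b x + (if b then s else 0))" for b x
  define R where "R b x = (if x \<in> A then r b x else r' b x + (if b then s else 0))" for b x
  have far: "\<not> L True y \<le> R True x" if "x \<in> A" "y \<in> B" for x y
    using s[OF that] that assms(5) by (auto simp: L_def R_def)
  have "boxes E (A \<union> B) L R"
    unfolding boxes_def
  proof (intro conjI ballI impI allI)
    fix x b assume "x \<in> A \<union> B"
    then show "L b x \<le> R b x"
      using assms(1,2) by (auto simp: L_def R_def boxes_def)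
  next
    fix x y assume "x \<in> A \<union> B" "y \<in> A \<union> B" "x \<noteq> y"
    then consider "x \<in> A" "y \<in> A" | "x \<in> B" "y \<in> B" "x \<notin> A" "y \<notin> A"
      | "x \<in> A" "y \<in> B" | "x \<in> B" "y \<in> A" using assms(5) by blast
    then show "E x y \<longleftrightarrow> (\<forall>b. L b x \<le> R b y \<and> L b y \<le> R b x)"
    proof cases
      case 1
      then show ?thesis using assms(1) \<open>x \<noteq> y\<close> by (simp add: L_def R_def boxes_def)
    next
      case 2
      then show ?thesis using assms(2) \<open>x \<noteq> y\<close> by (simp add: L_def R_def boxes_def)
    next
      case 3
      then show ?thesis using assms(6) far by blast
    next
      case 4
      then show ?thesis using assms(6) far by blast
    qed
  qed
  then show ?thesis by blast
qed

section \<open>The boxes of one component\<close>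

context longest_induced_path
begin

lemma boxes_path_and_attached:
  assumes "finite S"
  shows "\<exists>l r. boxes E (u ` {..m} \<union> {w. \<exists>i\<le>m. E w (u i)}) l r"
proof -
  define D where "D = {w. off w \<and> (\<exists>i\<le>m. E w (u i))}"
  define lo where "lo w = Min {i. i \<le> m \<and> E w (u i)}" for w
  define hi where "hi w = Max {i. i \<le> m \<and> E w (u i)}" for w
  have lohi: "E w (u (lo w))" "E w (u (hi w))" "lo w \<le> hi w" "hi w \<le> m"
    "\<And>i. i \<le> m \<Longrightarrow> E w (u i) \<longleftrightarrow> i = lo w \<or> i = hi w" "hi w = lo w \<or> hi w = lo w + 3"
    if "w \<in> D" for w
  proof -
    let ?N = "{i. i \<le> m \<and> E w (u i)}"
    have ne: "finite ?N" "?N \<noteq> {}" using that by (auto simp: D_def)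
    have lo: "lo w \<in> ?N" and hi: "hi w \<in> ?N"
      unfolding lo_def hi_def using Min_in[OF ne] Max_in[OF ne] by auto
    have bd: "lo w \<le> i" "i \<le> hi w" if "i \<in> ?N" for i
      unfolding lo_def hi_def using that ne by auto
    have off: "off w" using that by (simp add: D_def)
    show 1: "E w (u (lo w))" "E w (u (hi w))" "lo w \<le> hi w" "hi w \<le> m"
      using lo hi bd by auto
    show 2: "hi w = lo w \<or> hi w = lo w + 3"
      using nbr_gap[OF off, of "lo w" "hi w"] 1 by linarith
    show "E w (u i) \<longleftrightarrow> i = lo w \<or> i = hi w" if "i \<le> m" for i
    proof
      assume i: "E w (u i)"
      then have "lo w \<le> i" "i \<le> hi w" using bd that by auto
      then show "i = lo w \<or> i = hi w"
        using nbr_gap[OF off, of "lo w" i] 1 2 i that by linarith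
    qed (use 1 in auto)
  qed
  have nested: False if "w \<in> D" "x \<in> D" "lo w < j" "j < hi w" "j = lo x \<or> j = hi x" for w x j
    using nothing_attached_inside_C5[of w "lo w" "hi w" j x] lohi[of w] lohi[of x] that
    by (auto simp: D_def)
  have "D \<subseteq> S" using nbr_in by (auto simp: D_def)
  then have "finite D" using assms finite_subset by blast
  from finite_imp_inj_to_nat_seg[OF this] obtain h :: "'a \<Rightarrow> nat" where h: "inj_on h D"
    by auto
  \<comment> \<open>Private offsets: distinct because \<open>h\<close> is injective, and within
    (1/4, 3/4) because 1/3 is the largest second summand. They thus avoid the offsets 3/4 and 1/4 of
    the long intervals.\<close>
  define g where "g w = 1 / 4 + 1 / (real (h w) + 3)" for w
  have g: "1 / 4 < g w" "g w < 3 / 4" for w by (auto simp: g_def field_simps)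
  have g_inj: "g w \<noteq> g x" if "w \<in> D" "x \<in> D" "w \<noteq> x" for w x
    using inj_onD[OF h] that by (auto simp: g_def field_simps)
  define idx where "idx = inv_into {..m} u"
  have idx: "idx (u i) = i" if "i \<le> m" for i
    unfolding idx_def by (rule inv_into_f_f) (use path that in \<open>auto simp: induced_path_def\<close>)
  define l :: "bool \<Rightarrow> 'a \<Rightarrow> real" where
    "l b x = (if b then (if off x then (if lo x = hi x then lo x + g x else lo x + 3 / 4) else idx x)
       else (if off x then 1 else 0))" for b x
  define r :: "bool \<Rightarrow> 'a \<Rightarrow> real" where
    "r b x = (if b then (if off x then (if lo x = hi x then lo x + g x else hi x + 1 / 4)
         else idx x + 1)
       else (if off x then 1 else if \<exists>w\<in>D. lo w < idx x \<and> idx x < hi w then 0 else 1))" for b x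
  \<comment> \<open>Offsets lie strictly inside unit intervals, so meeting \<open>[i, i + 1]\<close>
    depends only on comparing \<open>i\<close> with \<open>lo w\<close> and
    \<open>hi w\<close>.\<close>
  have between: "lo w < l True w" "l True w < lo w + 1" "hi w < r True w" "r True w < hi w + 1"
    if "w \<in> D" for w
    using g[of w] that by (auto simp: l_def r_def D_def)
  have path_interval: "l True (u i) = real i" "r True (u i) = real i + 1" if "i \<le> m" for i
    using that by (auto simp: l_def r_def idx)
  define meet where "meet x y \<longleftrightarrow> (\<forall>b. l b x \<le> r b y \<and> l b y \<le> r b x)" for x y
  have meet_commute: "meet x y \<longleftrightarrow> meet y x" for x y by (auto simp: meet_def)
  have pp: "E (u i) (u j) \<longleftrightarrow> meet (u i) (u j)" if "i \<le> m" "j \<le> m" "i \<noteq> j" for i j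
  proof -
    have "meet (u i) (u j) \<longleftrightarrow> i \<le> j + 1 \<and> j \<le> i + 1"
      using that by (auto simp: meet_def l_def r_def idx all_bool_eq)
    then show ?thesis using that adj by auto
  qed
  have po: "E w (u i) \<longleftrightarrow> meet w (u i)" if "i \<le> m" "w \<in> D" for i w
  proof -
    have off: "off w" using that by (simp add: D_def)
    have "l True w \<le> real i + 1 \<longleftrightarrow> lo w \<le> i" "real i \<le> r True w \<longleftrightarrow> i \<le> hi w"
      using between[OF that(2)] by linarith+
    then have "l True w \<le> r True (u i) \<and> l True (u i) \<le> r True w \<longleftrightarrow> lo w \<le> i \<and> i \<le> hi w"
      using path_interval[OF that(1)] by simp
    moreover have "l False w \<le> r False (u i) \<and> l False (u i) \<le> r False w
        \<longleftrightarrow> \<not> (\<exists>x\<in>D. lo x < i \<and> i < hi x)"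
      using that(1) off by (auto simp: l_def r_def idx)
    ultimately have "meet w (u i) \<longleftrightarrow> lo w \<le> i \<and> i \<le> hi w \<and> \<not> (\<exists>x\<in>D. lo x < i \<and> i < hi x)"
      by (auto simp: meet_def all_bool_eq)
    \<comment> \<open>If \<open>i\<close> is strictly between, \<open>w\<close> itself is a witness
      \<open>x\<close>; if \<open>i\<close> is an attachment of \<open>w\<close>,
      \<open>nested\<close> excludes every witness.\<close>
    also have "\<dots> \<longleftrightarrow> i = lo w \<or> i = hi w"
      using nested[OF _ that(2)] that(2) lohi(3)[OF that(2)]
      by (metis le_neq_implies_less order_refl)
    finally show ?thesis using lohi(5)[OF that(2,1)] by simp
  qed
  have oo: "\<not> meet w x" if wx: "w \<in> D" "x \<in> D" "w \<noteq> x" "lo w \<le> lo x" for w x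
  proof
    assume "meet w x"
    then have le: "l True x \<le> r True w" "l True w \<le> r True x" by (auto simp: meet_def)
    have off: "off w" "off x" using that by (auto simp: D_def)
    have "lo x \<le> hi w" using le(1) between(1)[OF wx(2)] between(4)[OF wx(1)] by linarith
    \<comment> \<open>By \<open>nested\<close>, \<open>lo x\<close> cannot lie strictly between
      \<open>lo w\<close> and \<open>hi w\<close>.\<close>
    then consider (same) "lo x = lo w" | (touch) "lo x = hi w" "lo w \<noteq> hi w"
      using nested[OF wx(1,2), of "lo x"] wx(4) by force
    then show False
    proof cases
      case same
      \<comment> \<open>Two long intervals with the same start would come from a 4-cycle. So at
        least one of the two is a private point, and these lie below offset 3/4.\<close>
      have "lo w \<noteq> hi w \<Longrightarrow> lo x = hi x"
        using no_C4[of w "u (lo w)" x "u (hi w)"] lohi(1-4,6)[OF wx(1)] lohi(1-4,6)[OF wx(2)]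
          same wx(3) sym vertex_eq[of "lo w" "hi w"] by (metis le_trans)
      then show ?thesis
        using same le off g[of w] g[of x] g_inj[OF wx(1-3)] by (auto simp: l_def r_def split: if_splits)
    next
      case touch
      \<comment> \<open>The interval of \<open>w\<close> ends at offset 1/4 past
        \<open>hi w\<close>, while that of \<open>x\<close> starts at a larger offset past the same
        index.\<close>
      then show ?thesis
        using le off g[of x] by (auto simp: l_def r_def split: if_splits)
    qed
  qed
  have dom: "u ` {..m} \<union> {w. \<exists>i\<le>m. E w (u i)} = u ` {..m} \<union> D" by (auto simp: D_def)
  have "boxes E (u ` {..m} \<union> D) l r"
    unfolding boxes_def meet_def[symmetric]
  proof (intro conjI ballI impI allI)
    fix x b assume x: "x \<in> u ` {..m} \<union> D"
    then show "l b x \<le> r b x"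
      using lohi(3)[of x] by (auto simp: l_def r_def)
  next
    fix x y assume "x \<in> u ` {..m} \<union> D" "y \<in> u ` {..m} \<union> D" "x \<noteq> y"
    then consider i j where "x = u i" "y = u j" "i \<le> m" "j \<le> m" "i \<noteq> j"
      | i where "x = u i" "i \<le> m" "y \<in> D" | i where "y = u i" "i \<le> m" "x \<in> D"
      | "x \<in> D" "y \<in> D" by auto
    then show "E x y \<longleftrightarrow> meet x y"
    proof cases
      case 1
      then show ?thesis using pp by auto
    next
      case 2
      then show ?thesis using po[of i y] adj_commute[of x y] meet_commute[of x y] by auto
    next
      case 3
      then show ?thesis using po by auto
    next
      case 4
      have "\<not> E x y" using 4 attached_not_adjacent by (auto simp: D_def)
      moreover have "\<not> meet x y"
        using oo[of x y] oo[of y x] 4 \<open>x \<noteq> y\<close> meet_commute[of x y] nat_le_linear by blast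
      ultimately show ?thesis by simp
    qed
  qed
  then show ?thesis unfolding dom by blast
qed

end

section \<open>Assembling the components\<close>

context AT_free_girth5
begin

text \<open>The \<open>k + 1\<close> vertices of an induced path are distinct elements of
  \<open>S\<close>, which bounds \<open>k\<close>.\<close>

lemma longest_induced_path_exists:
  assumes "finite S" "S \<noteq> {}"
  obtains u m where "induced_path E S u m" "\<And>v k. induced_path E S v k \<Longrightarrow> k \<le> m"
proof -
  define P where "P k \<longleftrightarrow> (\<exists>v. induced_path E S v k)" for k
  obtain x where "x \<in> S" using assms by blast
  have "P 0"
    unfolding P_def induced_path_def using \<open>x \<in> S\<close> irrefl by (intro exI[of _ "\<lambda>_. x"]) auto
  moreover have bound: "k \<le> card S" if "P k" for k
  proof -
    obtain v where v: "induced_path E S v k" using \<open>P k\<close> P_def by blast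
    then have "card {..k} \<le> card S"
      using assms(1) by (intro card_inj_on_le[of v]) (auto simp: induced_path_def)
    then show ?thesis by simp
  qed
  ultimately have "P (Greatest P)" "\<And>k. P k \<Longrightarrow> k \<le> Greatest P"
    using GreatestI_nat[of P 0 "card S"] Greatest_le_nat[of P _ "card S"] by auto
  then show thesis using that unfolding P_def by blast
qed

text \<open>Induction splitting off the component \<open>D\<close> of a longest induced path: the
  rest is again closed under adjacency, and smaller because \<open>u 0\<close> lies in
  \<open>D\<close>.\<close>

lemma boxes_exist:
  assumes "finite S" "\<And>x y. x \<in> S \<Longrightarrow> E x y \<Longrightarrow> y \<in> S"
  shows "\<exists>l r. boxes E S l r"
  using assms
proof (induction S rule: finite_psubset_induct)
  case (psubset S)
  show ?case
  proof (cases "S = {}")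
    case True
    then show ?thesis by (simp add: boxes_def)
  next
    case False
    then obtain u m where um: "induced_path E S u m" "\<And>v k. induced_path E S v k \<Longrightarrow> k \<le> m"
      using longest_induced_path_exists psubset(1) by metis
    interpret longest_induced_path E S u m
      using psubset(3) um by unfold_locales auto
    define D where "D = u ` {..m} \<union> {w. \<exists>i\<le>m. E w (u i)}"
    have D: "D \<subseteq> S" using vertex_in nbr_in by (auto simp: D_def)
    have D_closed: "y \<in> D" if "x \<in> D" "E x y" for x y
    proof (cases "off x")
      case True
      then obtain i where "i \<le> m" "E x (u i)" using \<open>x \<in> D\<close> by (auto simp: D_def)
      then have "\<not> off y"
        using nbr_of_attached_on_path[OF True] sym[OF \<open>E x y\<close>] by blast
      then show ?thesis by (auto simp: D_def)
    next
      case False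
      then show ?thesis using sym[OF \<open>E x y\<close>] by (auto simp: D_def)
    qed
    have "u 0 \<in> D" by (auto simp: D_def)
    then have "S - D \<subset> S" using D by blast
    moreover have "y \<in> S - D" if "x \<in> S - D" "E x y" for x y
      using that D_closed sym psubset(3) by blast
    ultimately obtain l' r' where "boxes E (S - D) l' r'" using psubset(2)[of "S - D"] by blast
    moreover obtain l r where "boxes E D l r"
      using boxes_path_and_attached[OF psubset(1)] unfolding D_def by blast
    ultimately have "\<exists>l r. boxes E (D \<union> (S - D)) l r"
      using boxes_Un[of E D l r "S - D" l' r'] psubset(1) D D_closed sym finite_subset by blast
    then show ?thesis using D by (simp add: Un_absorb1)
  qed
qed

end

section \<open>Transfer to graphs and conclusion\<close>

text \<open>The route is a walk; shortening it to a path introduces no new vertices.\<close>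

lemma path_avoiding_if_missing_route:
  assumes "pair_graph G" "missing_route (\<lambda>x y. (x, y) \<in> parcs G) c a b" "a \<noteq> b"
  shows "path_avoiding G a b (neighbourhood G c)"
proof -
  interpret pair_graph G by fact
  \<comment> \<open>The trivial route says nothing about the neighbourhood of \<open>c\<close>,
    hence the separate disjunct.\<close>
  have "a = b \<or> (\<exists>p. awalk a p b \<and> p \<noteq> [] \<and> set (pawalk_verts a p) \<inter> neighbourhood G c = {})"
    using assms(2) unfolding missing_route_def
  proof (induction rule: converse_rtranclp_induct)
    case base
    then show ?case by simp
  next
    case (step x y)
    have e: "(x, y) \<in> parcs G" "x \<notin> neighbourhood G c" "y \<notin> neighbourhood G c"
      using step(1) by (auto simp: neighbourhood_def)
    from step(3) show ?case
    proof
      assume "y = b"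
      then show ?thesis
        using e arc_fst_in_verts[OF e(1)] arc_snd_in_verts[OF e(1)]
        by (intro disjI2 exI[of _ "[(x, y)]"]) (auto simp: awalk_def)
    next
      assume "\<exists>p. awalk y p b \<and> p \<noteq> [] \<and> set (pawalk_verts y p) \<inter> neighbourhood G c = {}"
      then obtain p where "awalk y p b" "set (pawalk_verts y p) \<inter> neighbourhood G c = {}" by blast
      then show ?thesis
        using e arc_fst_in_verts[OF e(1)]
        by (intro disjI2 exI[of _ "(x, y) # p"]) (auto simp: awalk_def)
    qed
  qed
  then obtain p where p: "awalk a p b" "set (pawalk_verts a p) \<inter> neighbourhood G c = {}"
    using \<open>a \<noteq> b\<close> by blast
  let ?q = "awalk_to_apath p"
  have q: "apath a ?q b" by (rule apath_awalk_to_apath[OF p(1)])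
  have "set ?q \<subseteq> set p" by (rule awalk_to_apath_subset[OF p(1)])
  then have "set (pawalk_verts a ?q) \<subseteq> set (pawalk_verts a p)"
    using set_awalk_verts[OF p(1)] set_awalk_verts[OF awalkI_apath[OF q]] by auto
  then show ?thesis
    using q p(2) unfolding path_avoiding_def by auto
qed

lemma AT_free_girth5_parcs:
  assumes "pair_graph G" "AT_free G" "girth G \<ge> 5"
  shows "AT_free_girth5 (\<lambda>x y. (x, y) \<in> parcs G)"
proof -
  interpret pair_graph G by fact
  have long: "5 \<le> length p" if "cycle p" "3 \<le> length p" for p
  proof -
    have "girth G \<le> enat (length p)"
      unfolding girth_def by (rule INF_lower) (use that in auto)
    then have "5 \<le> enat (length p)" using assms(3) by (rule order.trans[rotated])
    then show ?thesis by (simp add: numeral_eq_enat)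
  qed
  have symE: "(y, x) \<in> parcs G" if "(x, y) \<in> parcs G" for x y
    using that pair_sym_arcs by (auto simp: symmetric_def dest: symD)
  have loop: "(x, x) \<notin> parcs G" for x using pair_no_loops by force
  have C3: "(z, x) \<notin> parcs G" if "(x, y) \<in> parcs G" "(y, z) \<in> parcs G" for x y z
  proof
    assume "(z, x) \<in> parcs G"
    then have "cycle [(x, y), (y, z), (z, x)]"
      using that loop arc_fst_in_verts by (force simp: cycle_def awalk_def)
    then show False using long by fastforce
  qed
  have C4: "(d, a) \<notin> parcs G"
    if "(a, b) \<in> parcs G" "(b, c) \<in> parcs G" "(c, d) \<in> parcs G" "a \<noteq> c" "b \<noteq> d" for a b c d
  proof
    assume "(d, a) \<in> parcs G"
    then have "cycle [(a, b), (b, c), (c, d), (d, a)]"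
      using that loop arc_fst_in_verts by (force simp: cycle_def awalk_def)
    then show False using long by fastforce
  qed
  \<comment> \<open>A route between distinct vertices has a first and a last step, which put both
    ends outside the neighbourhood of \<open>c\<close>; this yields the independence of the
    triple.\<close>
  have ends: "a \<in> pverts G" "b \<in> pverts G" "(c, a) \<notin> parcs G" "(c, b) \<notin> parcs G"
    if "missing_route (\<lambda>x y. (x, y) \<in> parcs G) c a b" "a \<noteq> b" for a b c
    using that unfolding missing_route_def
    by (metis (no_types, lifting) converse_rtranclpE rtranclp.cases arc_fst_in_verts
        arc_snd_in_verts fst_conv snd_conv)+
  have False
    if d: "distinct [a, b, c]" and r: "missing_route (\<lambda>x y. (x, y) \<in> parcs G) c a b"
      "missing_route (\<lambda>x y. (x, y) \<in> parcs G) a b c" "missing_route (\<lambda>x y. (x, y) \<in> parcs G) b a c"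
    for a b c
  proof -
    have "independent G {a, b, c}"
      using d ends[OF r(1)] ends[OF r(2)] ends[OF r(3)] symE loop by (auto simp: independent_def)
    then have "asteroidal_triple G a b c"
      using d r path_avoiding_if_missing_route[OF assms(1)] by (auto simp: asteroidal_triple_def)
    then show False using assms(2) by (auto simp: AT_free_def)
  qed
  then show ?thesis using symE C3 C4 by unfold_locales blast+
qed

theorem theorem9:
  fixes G :: "'a pair_pre_digraph"
  assumes "pair_graph G"
    and "AT_free G"
    and "girth G \<ge> 5"
  shows "boxicity G \<le> 2"
proof -
  interpret pair_graph G by fact
  let ?E = "\<lambda>x y. (x, y) \<in> parcs G"
  interpret AT_free_girth5 ?E by (rule AT_free_girth5_parcs[OF assms])
  obtain l r where lr: "boxes ?E (pverts G) l r"
    using boxes_exist[OF pair_finite_verts] arc_snd_in_verts by force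
  \<comment> \<open>The truth value of \<open>i = 0\<close> turns a coordinate number into the
    Boolean index.\<close>
  define f where "f v = (\<Pi>\<^sub>E i\<in>{..<2::nat}. {l (i = 0) v..r (i = 0) v})" for v
  have "box_representation G 2 f"
    unfolding box_representation_def
  proof (intro conjI ballI impI)
    fix v assume "v \<in> pverts G"
    then show "is_box 2 (f v)"
      unfolding is_box_def f_def using lr
      by (intro exI[of _ "\<lambda>i. l (i = 0) v"] exI[of _ "\<lambda>i. r (i = 0) v"]) (auto simp: boxes_def)
  next
    fix x y assume xy: "x \<in> pverts G" "y \<in> pverts G" "x \<noteq> y"
    have ord: "l b x \<le> r b x" "l b y \<le> r b y" for b using lr xy by (auto simp: boxes_def)
    have "f x \<inter> f y = (\<Pi>\<^sub>E i\<in>{..<2}. {l (i = 0) x..r (i = 0) x} \<inter> {l (i = 0) y..r (i = 0) y})"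
      unfolding f_def by (rule PiE_Int)
    then have "f x \<inter> f y \<noteq> {} \<longleftrightarrow>
        (\<forall>i<2::nat. {l (i = 0) x..r (i = 0) x} \<inter> {l (i = 0) y..r (i = 0) y} \<noteq> {})"
      by (simp add: PiE_eq_empty_iff Ball_def)
    also have "\<dots> \<longleftrightarrow> (\<forall>b. {l b x..r b x} \<inter> {l b y..r b y} \<noteq> {})"
      by (auto simp: all_bool_eq less_2_cases_iff)
    also have "\<dots> \<longleftrightarrow> (\<forall>b. l b x \<le> r b y \<and> l b y \<le> r b x)"
      using ord by (simp add: Int_atLeastAtMost) blast
    also have "\<dots> \<longleftrightarrow> (x, y) \<in> parcs G"
      using lr xy by (auto simp: boxes_def)
    finally show "(x, y) \<in> parcs G \<longleftrightarrow> f x \<inter> f y \<noteq> {}" by simp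
  qed
  then have "boxicity G \<le> enat 2"
    unfolding boxicity_def by (intro INF_lower) auto
  then show ?thesis by (simp add: numeral_eq_enat)
qed

end
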